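(* Let $1<p<n$ be integers, $x_0\in\mathbb R^n$, $r>0$, and let $u\in C^3(B_r(x_0))\cap C^1(\overline{B_r(x_0)})$ be a $p$-plurisubharmonic function in the open ball $B_r(x_0)\subset\mathbb R^n$ which solves the equation $$\mathcal M_p(u)(x)=f(x,u(x))\quad\text{in } B_r(x_0),$$ for a given non-negative Lipschitz function $f=f(x,u)$. Then $$|Du(x_0)|\le C$$ for a constant $C$ depending only on $n$, $p$, $r$, $\sup_{B_r(x_0)}|u|$ and the Lipschitz bound of $f$.
   Context: A $C^2$ function $u$ on a domain $\Omega\subset\mathbb R^n$ is called $p$-plurisubharmonic if at every $x\in\Omega$ the eigenvalues $\lambda_1,\dots,\lambda_n$ of the Hessian $D^2u(x)$ satisfy $\lambda_{i_1}+\cdots+\lambda_{i_p}\ge 0$ for all $1\le i_1<\cdots<i_p\le n$. The operator $\mathcal M_p$ is defined by $$\mathcal M_p(u)(x)=\prod_{1\le i_1<i_2<\cdots<i_p\le n}(\lambda_{i_1}+\cdots+\lambda_{i_p}),$$ where $\lambda_1,\dots,\lambda_n$ are the eigenvalues of $D^2u(x)$. A constant $K$ is called a Lipschitz bound of $f$ if $|f|\le K$ and $\left|\frac{\partial f}{\partial u}\right|+\sum_j\left|\frac{\partial f}{\partial x_j}\right|\le K$. *)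

theory Defs
  imports "HOL-Analysis.Analysis" "HOL-Computational_Algebra.Polynomial"
begin

definition partial :: "'n::finite \<Rightarrow> (real^'n \<Rightarrow> real) \<Rightarrow> real^'n \<Rightarrow> real" where
  "partial i u x = frechet_derivative u (at x) (axis i 1)"

definition gradient :: "(real^'n::finite \<Rightarrow> real) \<Rightarrow> real^'n \<Rightarrow> real^'n" where
  "gradient u x = (\<chi> i. partial i u x)"

definition hessian :: "(real^'n::finite \<Rightarrow> real) \<Rightarrow> real^'n \<Rightarrow> real^'n^'n" where
  "hessian u x = (\<chi> i j. partial i (partial j u) x)"

text \<open>Intended for open \<open>\<Omega>\<close>. Differentiability is part of the definition because
  \<^const>\<open>frechet_derivative\<close> is unspecified where \<open>u\<close> is not differentiable.\<close>

primrec C_on :: "nat \<Rightarrow> (real^'n::finite) set \<Rightarrow> (real^'n \<Rightarrow> real) \<Rightarrow> bool" where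
  "C_on 0 \<Omega> u \<longleftrightarrow> continuous_on \<Omega> u"
| "C_on (Suc k) \<Omega> u \<longleftrightarrow>
     (\<forall>x\<in>\<Omega>. u differentiable at x) \<and> (\<forall>i. C_on k \<Omega> (partial i u))"

text \<open>The class \<open>C\<^sup>1\<close> of the closure: \<open>u\<close> is continuous up to the boundary and its first
  partial derivatives in the open set \<open>\<Omega>\<close> extend continuously to the boundary.\<close>

definition C1_on_closure :: "(real^'n::finite) set \<Rightarrow> (real^'n \<Rightarrow> real) \<Rightarrow> bool" where
  "C1_on_closure \<Omega> u \<longleftrightarrow> C_on 1 \<Omega> u \<and> continuous_on (closure \<Omega>) u \<and>
     (\<forall>i. \<exists>g. continuous_on (closure \<Omega>) g \<and> (\<forall>x\<in>\<Omega>. g x = partial i u x))"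

definition charpoly :: "real^'n^'n::finite \<Rightarrow> real poly" where
  "charpoly A = det (mat [:0, 1:] - (\<chi> i j. [:A $ i $ j:]))"

text \<open>The real eigenvalues in increasing order, repeated according to their multiplicity as
  roots of the characteristic polynomial. For a symmetric matrix (such as the Hessian
  of a \<open>C\<^sup>2\<close> function) this list has length \<open>n\<close>.\<close>

definition eigenvalues :: "real^'n^'n::finite \<Rightarrow> real list" where
  "eigenvalues A = sorted_list_of_multiset (proots (charpoly A))"

text \<open>An index tuple \<open>i\<^sub>1 < \<dots> < i\<^sub>p\<close> is represented by the set of its entries;
  indices start at 0.\<close>

definition p_plurisubharmonic ::
    "nat \<Rightarrow> (real^'n::finite) set \<Rightarrow> (real^'n \<Rightarrow> real) \<Rightarrow> bool" where
  "p_plurisubharmonic p \<Omega> u \<longleftrightarrow> C_on 2 \<Omega> u \<and>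
     (\<forall>x\<in>\<Omega>. \<forall>I. I \<subseteq> {..<CARD('n)} \<and> card I = p \<longrightarrow>
        (\<Sum>i\<in>I. eigenvalues (hessian u x) ! i) \<ge> 0)"

definition M_op :: "nat \<Rightarrow> (real^'n::finite \<Rightarrow> real) \<Rightarrow> real^'n \<Rightarrow> real" where
  "M_op p u x = (\<Prod>I\<in>{I. I \<subseteq> {..<CARD('n)} \<and> card I = p}.
     \<Sum>i\<in>I. eigenvalues (hessian u x) ! i)"

definition lipschitz_fun :: "(real^'n::finite) set \<Rightarrow> (real^'n \<Rightarrow> real \<Rightarrow> real) \<Rightarrow> bool" where
  "lipschitz_fun \<Omega> f \<longleftrightarrow> (\<exists>L. L-lipschitz_on (\<Omega> \<times> UNIV) (\<lambda>(x, z). f x z))"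

text \<open>A Lipschitz function need only be differentiable almost everywhere, so the bound on its
  partial derivatives is an almost-everywhere condition (with respect to Lebesgue measure in
  \<open>(x, z)\<close>, where \<open>z\<close> is the variable that is later set to \<open>u x\<close>).\<close>

definition lipschitz_bound ::
    "(real^'n::finite) set \<Rightarrow> (real^'n \<Rightarrow> real \<Rightarrow> real) \<Rightarrow> real \<Rightarrow> bool" where
  "lipschitz_bound \<Omega> f K \<longleftrightarrow>
     (\<forall>x\<in>\<Omega>. \<forall>z. \<bar>f x z\<bar> \<le> K) \<and>
     (AE y in lborel. fst y \<in> \<Omega> \<longrightarrow>
        (\<lambda>(x, z). f x z) differentiable at y \<and>
        (let D = frechet_derivative (\<lambda>(x, z). f x z) (at y)
         in \<bar>D (0, 1)\<bar> + (\<Sum>j\<in>UNIV. \<bar>D (axis j 1, 0)\<bar>) \<le> K))"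

end

theory Submission
  imports Defs
begin

text \<open>
  The equation is never differentiated. If \<open>K\<close> bounds \<open>f\<close>, then at every point some sum of
  \<open>p\<close> eigenvalues of \<open>D\<^sup>2u\<close> is at most \<open>K + 1\<close>, because a product of factors exceeding
  \<open>K + 1\<close> would exceed \<open>K\<close>. This and \<open>p\<close>-plurisubharmonicity suffice
  for a doubling-of-variables argument in the style of Ishii and Lions: consider
  \<open>u x - u y - L (s - s\<^sup>2 / 4\<delta>) - M \<bar>x - x\<^sub>0\<bar>\<^sup>2\<close> with \<open>s = \<bar>x - y\<bar>\<close>.
  At an interior positive maximum, with \<open>e = (x - y) / s\<close>, concavity of the penalty makes
  \<open>D\<^sup>2u x e e\<close> very negative. Testing \<open>D\<^sup>2u x\<close> against \<open>D\<^sup>2u y\<close> along a \<open>p\<close>-plane \<open>V\<close>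
  with trace \<open>\<le> K + 1\<close> at \<open>y\<close>, once with \<open>V\<close> itself and once with its reflection in
  \<open>e\<^sup>\<bottom>\<close>, bounds the trace of \<open>D\<^sup>2u x\<close> on the projection of \<open>V\<close> to \<open>e\<^sup>\<bottom>\<close>. Together with the
  direction \<open>e\<close> this contradicts \<open>p\<close>-plurisubharmonicity at \<open>x\<close> once \<open>L\<close> is large.
\<close>

section \<open>Spectral theorem for real symmetric matrices\<close>

lemma symmetric_matrix_dot:
  fixes A :: "real^'n^'n::finite"
  assumes "transpose A = A"
  shows "x \<bullet> (A *v y) = (A *v x) \<bullet> y"
  by (metis assms dot_lmul_matrix transpose_matrix_vector)

text \<open>Maximise the quadratic form of \<open>A\<close> over the unit sphere of
  \<open>W\<close>, the orthogonal complement of \<open>B\<close>. Since \<open>B\<close> consists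
  of eigenvectors and \<open>A\<close> is symmetric, \<open>A\<close> maps \<open>W\<close> into
  itself, so the residual \<open>A *v v - l *\<^sub>R v\<close> at a maximiser \<open>v\<close> is
  an admissible direction of variation and must vanish.\<close>

lemma symmetric_matrix_eigenvector_orthogonal:
  fixes A :: "real^'n^'n::finite"
  assumes sym: "transpose A = A" and "finite B" "card B < CARD('n)"
    and eig: "\<And>b. b \<in> B \<Longrightarrow> \<exists>l. A *v b = l *\<^sub>R b"
  obtains v l where "norm v = 1" "\<And>b. b \<in> B \<Longrightarrow> orthogonal v b" "A *v v = l *\<^sub>R v"
proof -
  define W where "W = {x. \<forall>b\<in>B. orthogonal x b}"
  have "dim B < DIM(real^'n)"
    using dim_le_card'[OF \<open>finite B\<close>] assms(3) by simp
  then obtain z where z: "z \<noteq> 0" "\<And>b. b \<in> span B \<Longrightarrow> orthogonal z b"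
    using orthogonal_to_subspace_exists by metis
  have subW: "subspace W"
    unfolding W_def subspace_def orthogonal_def by (auto simp: inner_add_left)
  have "closed W"
  proof -
    have "W = (\<Inter>b\<in>B. {x. x \<bullet> b = 0})" by (auto simp: W_def orthogonal_def)
    then show ?thesis by (auto intro!: closed_INT closed_Collect_eq continuous_intros)
  qed
  then have "compact (W \<inter> sphere 0 1)"
    by (simp add: closed_Int_compact)
  moreover have "z /\<^sub>R norm z \<in> W \<inter> sphere 0 1"
    using z by (auto simp: W_def span_base orthogonal_def)
  moreover have "continuous_on (W \<inter> sphere 0 1) (\<lambda>x. x \<bullet> (A *v x))"
    by (intro continuous_intros linear_continuous_on linear_conv_bounded_linear[THEN iffD1]) auto
  ultimately obtain v where v: "v \<in> W \<inter> sphere 0 1"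
    and vmax: "\<And>x. x \<in> W \<inter> sphere 0 1 \<Longrightarrow> x \<bullet> (A *v x) \<le> v \<bullet> (A *v v)"
    using continuous_attains_sup[of "W \<inter> sphere 0 1" "\<lambda>x. x \<bullet> (A *v x)"] by blast
  define l where "l = v \<bullet> (A *v v)"
  have nv: "norm v = 1" using v by simp
  have max: "x \<bullet> (A *v x) \<le> l * (norm x)\<^sup>2" if "x \<in> W" for x
  proof (cases "x = 0")
    case False
    then have "(x /\<^sub>R norm x) \<in> W \<inter> sphere 0 1"
      using that subW by (auto simp: subspace_scale)
    from vmax[OF this] False show ?thesis
      by (simp add: l_def matrix_vector_mult_scaleR field_simps power2_eq_square)
  qed simp
  define w where "w = A *v v - l *\<^sub>R v"
  have "w \<in> W"
    unfolding W_def
  proof clarify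
    fix b assume b: "b \<in> B"
    then obtain k where "A *v b = k *\<^sub>R b" using eig by blast
    moreover have "v \<bullet> b = 0" using v b by (auto simp: W_def orthogonal_def)
    ultimately show "orthogonal w b"
      using symmetric_matrix_dot[OF sym, of v b]
      by (simp add: w_def orthogonal_def inner_diff_left)
  qed
  have "w = 0"
  proof (rule ccontr)
    assume "w \<noteq> 0"
    \<comment> \<open>Moving from \<open>v\<close> to \<open>v + t *\<^sub>R w\<close> changes the
      form minus \<open>l\<close> times the squared norm by
      \<open>t * (2 * \<alpha> + t * \<beta>)\<close>. The choice
      \<open>t = \<alpha> / (\<bar>\<beta>\<bar> + 1)\<close> below is positive and small enough for
      the linear term to dominate.\<close>
    define \<alpha> \<beta> where "\<alpha> = w \<bullet> w" and "\<beta> = w \<bullet> (A *v w) - l * (w \<bullet> w)"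
    have \<alpha>: "\<alpha> > 0" using \<open>w \<noteq> 0\<close> by (simp add: \<alpha>_def)
    have q: "t * (2 * \<alpha> + t * \<beta>) \<le> 0" for t
    proof -
      have "v + t *\<^sub>R w \<in> W"
        using v \<open>w \<in> W\<close> subW by (auto intro: subspace_add subspace_scale)
      from max[OF this] have
        "(v + t *\<^sub>R w) \<bullet> (A *v (v + t *\<^sub>R w)) \<le> l * ((v + t *\<^sub>R w) \<bullet> (v + t *\<^sub>R w))"
        by (simp add: power2_norm_eq_inner)
      moreover have "v \<bullet> (A *v w) = w \<bullet> (A *v v)"
        using symmetric_matrix_dot[OF sym, of v w] by (simp add: inner_commute)
      moreover have "w \<bullet> (A *v v) = \<alpha> + l * (v \<bullet> w)"
        by (simp add: \<alpha>_def w_def inner_diff_left inner_diff_right algebra_simps inner_commute)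
      moreover have "v \<bullet> v = 1" using nv by (simp add: norm_eq_1)
      ultimately show ?thesis
        by (simp add: \<beta>_def l_def[symmetric] \<alpha>_def[symmetric] matrix_vector_right_distrib
            matrix_vector_mult_scaleR inner_add_left inner_add_right inner_commute[of w v]
            algebra_simps power2_eq_square)
    qed
    have "\<alpha> / (\<bar>\<beta>\<bar> + 1) * (- \<beta>) \<le> \<alpha>"
    proof -
      have "\<alpha> * (- \<beta>) \<le> \<alpha> * (\<bar>\<beta>\<bar> + 1)"
        using \<alpha> by (intro mult_left_mono) auto
      then show ?thesis by (simp add: field_simps)
    qed
    then have "2 * \<alpha> + \<alpha> / (\<bar>\<beta>\<bar> + 1) * \<beta> > 0" using \<alpha> by linarith
    moreover have "\<alpha> / (\<bar>\<beta>\<bar> + 1) > 0" using \<alpha> by simp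
    ultimately show False using q[of "\<alpha> / (\<bar>\<beta>\<bar> + 1)"] by (meson mult_pos_pos not_less)
  qed
  then show thesis
    using that[of v l] nv v by (auto simp: w_def W_def)
qed

lemma symmetric_matrix_orthonormal_eigenvectors:
  fixes A :: "real^'n^'n::finite"
  assumes sym: "transpose A = A" and "k \<le> CARD('n)"
  shows "\<exists>B. finite B \<and> card B = k \<and> pairwise orthogonal B \<and>
    (\<forall>b\<in>B. norm b = 1 \<and> (\<exists>l. A *v b = l *\<^sub>R b))"
  using assms(2)
proof (induction k)
  case 0
  then show ?case by (intro exI[of _ "{}"]) auto
next
  case (Suc k)
  then obtain B where B: "finite B" "card B = k" "pairwise orthogonal B"
    "\<And>b. b \<in> B \<Longrightarrow> norm b = 1 \<and> (\<exists>l. A *v b = l *\<^sub>R b)"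
    by (meson Suc_leD)
  then obtain v l where v: "norm v = 1" "\<And>b. b \<in> B \<Longrightarrow> orthogonal v b" "A *v v = l *\<^sub>R v"
    using symmetric_matrix_eigenvector_orthogonal[OF sym, of B] Suc.prems by auto
  have "v \<notin> B"
    using v(1) v(2)[of v] by (auto simp: orthogonal_self)
  then show ?case
    using B v by (intro exI[of _ "insert v B"]) (auto simp: pairwise_insert orthogonal_commute)
qed

lemma poly_charpoly:
  fixes A :: "real^'n^'n::finite"
  shows "poly (charpoly A) x = det (mat x - A)"
  unfolding charpoly_def det_def
  by (simp add: poly_sum poly_prod mat_def of_int_poly)
    (intro sum.cong refl arg_cong2[where f="(*)"] prod.cong, auto)

text \<open>With the eigenvectors as columns of an orthogonal matrix \<open>Q\<close>,
  \<open>(mat x - A) ** Q = Q ** D\<close> for a diagonal \<open>D\<close>. Taking determinants at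
  every real \<open>x\<close> identifies the two polynomials by their values.\<close>

lemma charpoly_orthonormal_eigenvectors:
  fixes A :: "real^'n^'n::finite"
  assumes B: "card B = CARD('n)" "pairwise orthogonal B"
    and eig: "\<And>b. b \<in> B \<Longrightarrow> norm b = 1 \<and> A *v b = l b *\<^sub>R b"
  shows "charpoly A = (\<Prod>b\<in>B. [:- l b, 1:])"
proof (rule poly_ext)
  fix x
  have "finite B" using B(1) by (metis card.infinite zero_less_card_finite less_irrefl)
  then obtain f where f: "bij_betw f (UNIV :: 'n set) B"
    using B(1) by (metis finite_same_card_bij finite)
  have fB: "f j \<in> B" for j using f by (auto simp: bij_betw_def)
  define Q :: "real^'n^'n" where "Q = (\<chi> i j. f j $ i)"
  have col: "column j Q = f j" for j by (simp add: Q_def column_def vec_eq_iff)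
  have "orthogonal (f i) (f j)" if "i \<noteq> j" for i j
    using B(2) f fB that by (metis bij_betw_def injD pairwiseD)
  then have "orthogonal_matrix Q"
    by (simp add: orthogonal_matrix_orthonormal_columns col eig fB)
  then have dQ: "det Q \<noteq> 0" using det_orthogonal_matrix[of Q] by auto
  define D :: "real^'n^'n" where "D = (\<chi> i j. if i = j then x - l (f i) else 0)"
  have "(mat x - A) ** Q = Q ** D"
  proof (simp add: vec_eq_iff, intro allI)
    fix i j
    have "((mat x - A) ** Q) $ i $ j = ((mat x - A) *v f j) $ i"
      by (simp add: matrix_matrix_mult_def matrix_vector_mult_def Q_def)
    also have "\<dots> = (x - l (f j)) * f j $ i"
      using eig[OF fB[of j]]
      by (simp add: matrix_vector_mult_diff_rdistrib algebra_simps)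
        (simp add: mat_def matrix_vector_mult_def if_distrib[of "\<lambda>y. y * _"] cong: if_cong)
    also have "\<dots> = (Q ** D) $ i $ j"
      by (simp add: matrix_matrix_mult_def Q_def D_def if_distrib[of "\<lambda>y. _ * y"] cong: if_cong)
    finally show "((mat x - A) ** Q) $ i $ j = (Q ** D) $ i $ j" .
  qed
  then have "det (mat x - A) * det Q = det Q * det D"
    by (metis det_mul)
  then have "det (mat x - A) = det D" using dQ by simp
  also have "\<dots> = (\<Prod>i\<in>UNIV. x - l (f i))"
    by (subst det_diagonal) (auto simp: D_def)
  also have "\<dots> = (\<Prod>b\<in>B. x - l b)"
    using prod.reindex_bij_betw[OF f, of "\<lambda>b. x - l b"] by simp
  finally show "poly (charpoly A) x = poly (\<Prod>b\<in>B. [:- l b, 1:]) x"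
    by (simp add: poly_charpoly poly_prod)
qed

text \<open>Links the list \<open>eigenvalues A\<close>, which comes from roots of the
  characteristic polynomial, to vectors: position \<open>i\<close> in the list gets its own
  eigenvector \<open>q i\<close>, with multiplicities matched.\<close>

lemma eigenvalues_eigenbasis:
  fixes A :: "real^'n^'n::finite"
  assumes sym: "transpose A = A"
  obtains q :: "nat \<Rightarrow> real^'n"
  where "sorted (eigenvalues A)" "length (eigenvalues A) = CARD('n)"
    "\<And>i j. i < CARD('n) \<Longrightarrow> j < CARD('n) \<Longrightarrow> q i \<bullet> q j = (if i = j then 1 else 0)"
    "\<And>i. i < CARD('n) \<Longrightarrow> A *v q i = (eigenvalues A ! i) *\<^sub>R q i"
    "\<And>y. y = (\<Sum>i<CARD('n). (q i \<bullet> y) *\<^sub>R q i)"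
proof -
  obtain B where B: "finite B" "card B = CARD('n)" "pairwise orthogonal B"
    and nrm: "\<And>b. b \<in> B \<Longrightarrow> norm b = 1"
    and "\<forall>b\<in>B. \<exists>l. A *v b = l *\<^sub>R b"
    using symmetric_matrix_orthonormal_eigenvectors[OF sym order_refl] by metis
  then obtain l where l: "\<And>b. b \<in> B \<Longrightarrow> A *v b = l b *\<^sub>R b" by metis
  obtain xs where xs: "set xs = B" "distinct xs"
    using finite_distinct_list[OF B(1)] by blast
  \<comment> \<open>Sorting the eigenvectors by their eigenvalues makes \<open>map l ys\<close> the
    sorted list of roots, so both lists share their indices.\<close>
  define ys where "ys = sort_key l xs"
  have ys: "set ys = B" "distinct ys" "length ys = CARD('n)"
    using xs B(2) by (auto simp: ys_def distinct_card[symmetric])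
  have "charpoly A = (\<Prod>b\<in>B. [:- l b, 1:])"
    using charpoly_orthonormal_eigenvectors[OF B(2,3)] nrm l by auto
  then have "proots (charpoly A) = (\<Sum>b\<in>B. {#l b#})"
    by (simp add: proots_prod)
  also have "\<dots> = image_mset l (mset_set B)"
    by (induction B rule: infinite_finite_induct) auto
  also have "\<dots> = mset (map l ys)"
    using ys by (metis mset_map mset_set_set)
  finally have "eigenvalues A = sort (map l ys)"
    by (simp add: eigenvalues_def flip: mset_map)
  also have "\<dots> = map l ys"
    by (simp add: ys_def sorted_sort_id)
  finally have ev: "eigenvalues A = map l ys" .
  have "independent B"
    using B(3) nrm by (intro pairwise_orthogonal_independent) (auto dest: nrm)
  then have span: "span B = UNIV"
    using card_ge_dim_independent[of B UNIV] B(2) by auto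
  have expand: "y = (\<Sum>b\<in>B. (b \<bullet> y) *\<^sub>R b)" for y
    using orthonormal_basis_expand[OF B(3) nrm, of y] B(1) span by (simp add: inner_commute)
  show thesis
  proof (rule that[of "(!) ys"])
    show "sorted (eigenvalues A)" by (simp add: ev ys_def)
    show "length (eigenvalues A) = CARD('n)" by (simp add: ev ys)
    show "ys ! i \<bullet> ys ! j = (if i = j then 1 else 0)" if "i < CARD('n)" "j < CARD('n)" for i j
    proof -
      have "ys ! i \<in> B" "ys ! j \<in> B" using that ys by auto
      moreover have "ys ! i \<noteq> ys ! j" if "i \<noteq> j"
        using that \<open>i < _\<close> \<open>j < _\<close> ys by (simp add: nth_eq_iff_index_eq)
      ultimately show ?thesis
        using nrm B(3) by (auto simp: norm_eq_1 pairwise_def orthogonal_def)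
    qed
    show "A *v ys ! i = (eigenvalues A ! i) *\<^sub>R ys ! i" if "i < CARD('n)" for i
      using that l[of "ys ! i"] ys nth_mem[of i ys] by (simp add: ev)
    show "y = (\<Sum>i<CARD('n). (ys ! i \<bullet> y) *\<^sub>R ys ! i)" for y
    proof -
      have "bij_betw ((!) ys) {..<CARD('n)} B"
        using bij_betw_nth[OF ys(2)] ys by simp
      from sum.reindex_bij_betw[OF this, of "\<lambda>b. (b \<bullet> y) *\<^sub>R b"] expand[of y] show ?thesis
        by simp
    qed
  qed
qed

section \<open>From sums of \<open>p\<close> eigenvalues to traces of the quadratic form\<close>

text \<open>The hypotheses on \<open>y\<close> say that the sum of the matrices
  \<open>y j (y j)^T\<close> lies between 0 and the identity and has trace \<open>p\<close>. In an
  eigenbasis the trace of \<open>A\<close> against it is an average of eigenvalues with weights in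
  [0,1] of total \<open>p\<close>, and such an average is smallest when all the weight sits on the
  \<open>p\<close> lowest eigenvalues. Unlike an orthonormal \<open>p\<close>-frame, this allows
  rescaled vectors.\<close>

lemma sum_quadratic_form_nonneg:
  fixes A :: "real^'n^'n::finite" and y :: "'j \<Rightarrow> real^'n"
  assumes sym: "transpose A = A" and p: "0 < p" "p \<le> CARD('n)"
    and nonneg: "\<And>I. I \<subseteq> {..<CARD('n)} \<Longrightarrow> card I = p \<Longrightarrow> (\<Sum>i\<in>I. eigenvalues A ! i) \<ge> 0"
    and bessel: "\<And>z. (\<Sum>j\<in>J. (y j \<bullet> z)\<^sup>2) \<le> (norm z)\<^sup>2"
    and tr: "(\<Sum>j\<in>J. (norm (y j))\<^sup>2) = real p"
  shows "(\<Sum>j\<in>J. y j \<bullet> (A *v y j)) \<ge> 0"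
proof -
  obtain q where sorted: "sorted (eigenvalues A)" and len: "length (eigenvalues A) = CARD('n)"
    and on: "\<And>i j. i < CARD('n) \<Longrightarrow> j < CARD('n) \<Longrightarrow> q i \<bullet> q j = (if i = j then 1 else 0)"
    and eig: "\<And>i. i < CARD('n) \<Longrightarrow> A *v q i = (eigenvalues A ! i) *\<^sub>R q i"
    and expand: "\<And>y. y = (\<Sum>i<CARD('n). (q i \<bullet> y) *\<^sub>R q i)"
    by (rule eigenvalues_eigenbasis[OF sym]) (rule that)
  define \<mu> where "\<mu> i = eigenvalues A ! i" for i
  define \<omega> where "\<omega> i = (\<Sum>j\<in>J. (q i \<bullet> y j)\<^sup>2)" for i
  have "z \<bullet> w = (\<Sum>i<CARD('n). (q i \<bullet> z) * (q i \<bullet> w))" for z w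
    by (subst expand[of z]) (simp add: inner_sum_left)
  note dot = this
  have form: "z \<bullet> (A *v z) = (\<Sum>i<CARD('n). \<mu> i * (q i \<bullet> z)\<^sup>2)" for z
    unfolding dot[of z "A *v z"]
    by (intro sum.cong refl)
      (simp add: symmetric_matrix_dot[OF sym] eig \<mu>_def power2_eq_square)
  have nrm: "(norm z)\<^sup>2 = (\<Sum>i<CARD('n). (q i \<bullet> z)\<^sup>2)" for z
    unfolding power2_norm_eq_inner by (subst dot) (simp add: power2_eq_square)
  have \<omega>1: "\<omega> i \<le> 1" if "i < CARD('n)" for i
    using bessel[of "q i"] on[OF that that]
    by (simp add: \<omega>_def inner_commute power2_norm_eq_inner)
  have \<omega>0: "0 \<le> \<omega> i" for i by (simp add: \<omega>_def sum_nonneg)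
  have sum\<omega>: "(\<Sum>i<CARD('n). \<omega> i) = p"
    unfolding \<omega>_def by (subst sum.swap) (simp add: nrm[symmetric] tr)
  \<comment> \<open>The \<open>p\<close>-th smallest eigenvalue, as indices start at 0. It separates
    the eigenvalues whose weight should be 1 from those whose weight should be 0; \<open>key\<close>
    is \<open>(t - \<mu> i) * (1 - \<omega> i) \<ge> 0\<close> below the threshold and
    \<open>(\<mu> i - t) * \<omega> i \<ge> 0\<close> above it.\<close>
  define t where "t = \<mu> (p - 1)"
  have key: "t * \<omega> i + (if i < p then \<mu> i - t else 0) \<le> \<mu> i * \<omega> i" if "i < CARD('n)" for i
  proof (cases "i < p")
    case True
    then have "\<mu> i \<le> t" unfolding t_def \<mu>_def
      using p len by (intro sorted_nth_mono[OF sorted]) auto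
    then have "0 \<le> (t - \<mu> i) * (1 - \<omega> i)" using \<omega>1[OF that] by simp
    then show ?thesis using True by (simp add: algebra_simps)
  next
    case False
    then have "t \<le> \<mu> i" unfolding t_def \<mu>_def
      using that len by (intro sorted_nth_mono[OF sorted]) auto
    then show ?thesis using False \<omega>0[of i] by (simp add: mult_right_mono)
  qed
  have "0 \<le> (\<Sum>i<p. \<mu> i)"
    using nonneg[of "{..<p}"] p by (auto simp: \<mu>_def)
  also have "\<dots> = t * (\<Sum>i<CARD('n). \<omega> i) + (\<Sum>i<p. \<mu> i - t)"
    by (simp add: sum\<omega> sum_subtractf)
  also have "(\<Sum>i<p. \<mu> i - t) = (\<Sum>i<CARD('n). if i < p then \<mu> i - t else 0)"
    using p by (intro sum.mono_neutral_cong_left) auto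
  also have "t * (\<Sum>i<CARD('n). \<omega> i) + \<dots>
      = (\<Sum>i<CARD('n). t * \<omega> i + (if i < p then \<mu> i - t else 0))"
    by (simp add: sum_distrib_left sum.distrib)
  also have "\<dots> \<le> (\<Sum>i<CARD('n). \<mu> i * \<omega> i)"
    by (intro sum_mono key) auto
  also have "\<dots> = (\<Sum>j\<in>J. y j \<bullet> (A *v y j))"
    unfolding form \<omega>_def sum_distrib_left by (rule sum.swap)
  finally show ?thesis .
qed

section \<open>Derivatives along lines and symmetry of the Hessian\<close>

lemma has_derivative_gradient:
  fixes u :: "real^'n::finite \<Rightarrow> real"
  assumes "u differentiable at x"
  shows "(u has_derivative (\<lambda>v. gradient u x \<bullet> v)) (at x)"
proof -
  let ?F = "frechet_derivative u (at x)"
  have F: "(u has_derivative ?F) (at x)"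
    using assms frechet_derivative_works by blast
  then have lin: "linear ?F" by (rule has_derivative_linear)
  have "?F v = gradient u x \<bullet> v" for v
  proof -
    have "?F v = ?F (\<Sum>i\<in>UNIV. v $ i *\<^sub>R axis i 1)"
      by (simp add: basis_expansion flip: scalar_mult_eq_scaleR)
    also have "\<dots> = gradient u x \<bullet> v"
      by (simp add: linear_sum[OF lin] linear_cmul[OF lin] gradient_def partial_def inner_vec_def mult.commute)
    finally show ?thesis .
  qed
  then have "?F = (\<lambda>v. gradient u x \<bullet> v)" by (rule ext)
  with F show ?thesis by simp
qed

lemma has_real_derivative_line:
  fixes u :: "real^'n::finite \<Rightarrow> real"
  assumes "u differentiable at (x + t *\<^sub>R \<xi>)"
  shows "((\<lambda>t. u (x + t *\<^sub>R \<xi>)) has_real_derivative gradient u (x + t *\<^sub>R \<xi>) \<bullet> \<xi>) (at t)"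
proof -
  have "((\<lambda>t. x + t *\<^sub>R \<xi>) has_derivative (\<lambda>s. s *\<^sub>R \<xi>)) (at t)"
    by (auto intro!: derivative_eq_intros)
  from has_derivative_compose[OF this has_derivative_gradient[OF assms]] show ?thesis
    unfolding has_field_derivative_def by (simp add: mult_commute_abs)
qed

lemma has_real_derivative_gradient_line:
  fixes u :: "real^'n::finite \<Rightarrow> real"
  assumes "C_on 2 \<Omega> u" "x + t *\<^sub>R \<xi> \<in> \<Omega>"
  shows "((\<lambda>t. gradient u (x + t *\<^sub>R \<xi>) \<bullet> \<xi>) has_real_derivative
    \<xi> \<bullet> (hessian u (x + t *\<^sub>R \<xi>) *v \<xi>)) (at t)"
proof -
  have "partial j u differentiable at (x + t *\<^sub>R \<xi>)" for j
    using assms by (simp add: numeral_2_eq_2)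
  then have "((\<lambda>t. \<Sum>j\<in>UNIV. partial j u (x + t *\<^sub>R \<xi>) * \<xi> $ j) has_real_derivative
      (\<Sum>j\<in>UNIV. (gradient (partial j u) (x + t *\<^sub>R \<xi>) \<bullet> \<xi>) * \<xi> $ j)) (at t)"
    by (auto intro!: DERIV_sum DERIV_cmult_right has_real_derivative_line)
  moreover have "(\<Sum>j\<in>UNIV. (gradient (partial j u) y \<bullet> \<xi>) * \<xi> $ j) = \<xi> \<bullet> (hessian u y *v \<xi>)" for y
    unfolding inner_vec_def matrix_vector_mult_def hessian_def gradient_def
    by (simp add: sum_distrib_left sum_distrib_right) (subst sum.swap, simp add: mult_ac)
  ultimately show ?thesis
    by (simp add: gradient_def inner_vec_def)
qed

text \<open>The mean value theorem is applied twice: in direction \<open>i\<close> to the difference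
  of \<open>u\<close> across the square, then in direction \<open>j\<close> to
  \<open>partial i u\<close>. The second difference is symmetric in \<open>i\<close> and
  \<open>j\<close>, which is what makes the two orders of differentiation comparable.\<close>

lemma mixed_difference_mean_value:
  fixes u :: "real^'n::finite \<Rightarrow> real"
  assumes C: "C_on 2 \<Omega> u" and h: "0 < h" "cball x (2 * h) \<subseteq> \<Omega>"
  obtains y where "dist x y \<le> 2 * h"
    "u (x + h *\<^sub>R axis i 1 + h *\<^sub>R axis j 1) - u (x + h *\<^sub>R axis i 1)
      - u (x + h *\<^sub>R axis j 1) + u x = h\<^sup>2 * partial j (partial i u) y"
proof -
  define a b :: "real^'n" where "a = axis i 1" and "b = axis j 1"
  have nrm: "norm a = 1" "norm b = 1" by (simp_all add: a_def b_def)
  have in\<Omega>: "x + s *\<^sub>R a + t *\<^sub>R b \<in> \<Omega> \<and> dist x (x + s *\<^sub>R a + t *\<^sub>R b) \<le> 2 * h"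
    if "0 \<le> s" "s \<le> h" "0 \<le> t" "t \<le> h" for s t
  proof -
    have "norm (s *\<^sub>R a + t *\<^sub>R b) \<le> norm (s *\<^sub>R a) + norm (t *\<^sub>R b)" by (rule norm_triangle_ineq)
    moreover have "dist x (x + s *\<^sub>R a + t *\<^sub>R b) = norm (s *\<^sub>R a + t *\<^sub>R b)"
      unfolding dist_commute[of x] by (simp add: dist_norm add.assoc)
    ultimately have "dist x (x + s *\<^sub>R a + t *\<^sub>R b) \<le> 2 * h"
      using that nrm by simp
    then show ?thesis using h(2) by auto
  qed
  have d1: "u differentiable at z" "partial i u differentiable at z" if "z \<in> \<Omega>" for z
    using C that by (simp_all add: numeral_2_eq_2)
  have grad: "gradient w z \<bullet> axis k 1 = partial k w z" for w z and k :: 'n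
    by (simp add: gradient_def inner_axis)
  have L: "((\<lambda>s. w (c + s *\<^sub>R axis k 1)) has_real_derivative partial k w (c + s *\<^sub>R axis k 1)) (at s)"
    if "w differentiable at (c + s *\<^sub>R axis k 1)" for w s and c :: "real^'n" and k :: 'n
    using has_real_derivative_line[OF that] by (simp add: grad)
  define F where "F s = u (x + h *\<^sub>R b + s *\<^sub>R a) - u (x + s *\<^sub>R a)" for s
  have "DERIV F s :> partial i u (x + h *\<^sub>R b + s *\<^sub>R a) - partial i u (x + s *\<^sub>R a)"
    if "0 \<le> s" "s \<le> h" for s
    unfolding F_def a_def
    using in\<Omega>[of s h] in\<Omega>[of s 0] that h
    by (intro DERIV_diff L d1) (simp_all add: a_def add_ac)
  from MVT2[OF h(1) this] obtain s where s: "0 < s" "s < h"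
    and Fs: "F h - F 0 = h * (partial i u (x + h *\<^sub>R b + s *\<^sub>R a) - partial i u (x + s *\<^sub>R a))"
    by auto
  define G where "G t = partial i u (x + s *\<^sub>R a + t *\<^sub>R b)" for t
  have "DERIV G t :> partial j (partial i u) (x + s *\<^sub>R a + t *\<^sub>R b)" if "0 \<le> t" "t \<le> h" for t
    unfolding G_def b_def using in\<Omega>[of s t] that s
    by (intro L d1) (simp add: b_def)
  from MVT2[OF h(1) this] obtain t where t: "0 < t" "t < h"
    and Gt: "G h - G 0 = h * partial j (partial i u) (x + s *\<^sub>R a + t *\<^sub>R b)"
    by auto
  have "F h - F 0 = h * (G h - G 0)"
    unfolding Fs by (simp add: G_def add_ac)
  then have "F h - F 0 = h\<^sup>2 * partial j (partial i u) (x + s *\<^sub>R a + t *\<^sub>R b)"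
    by (simp add: Gt power2_eq_square)
  moreover have "F h - F 0 = u (x + h *\<^sub>R a + h *\<^sub>R b) - u (x + h *\<^sub>R a) - u (x + h *\<^sub>R b) + u x"
    by (simp add: F_def add.assoc add.commute[of "h *\<^sub>R b"])
  ultimately show thesis
    using that[of "x + s *\<^sub>R a + t *\<^sub>R b"] in\<Omega>[of s t] s t
    by (simp add: a_def b_def)
qed

text \<open>The same second difference equals \<open>h\<^sup>2\<close> times either mixed partial
  derivative at a point near \<open>x\<close>; continuity then forces agreement at
  \<open>x\<close>.\<close>

lemma hessian_symmetric:
  fixes u :: "real^'n::finite \<Rightarrow> real"
  assumes C: "C_on 2 \<Omega> u" and "open \<Omega>" "x \<in> \<Omega>"
  shows "transpose (hessian u x) = hessian u x"
proof -
  have "partial j (partial i u) x = partial i (partial j u) x" for i j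
  proof (rule ccontr)
    define f g where "f = partial j (partial i u)" and "g = partial i (partial j u)"
    assume "\<not> ?thesis"
    then have e: "dist (f x) (g x) / 2 > 0" (is "?e > 0") by (simp add: f_def g_def)
    have "continuous_on \<Omega> f" "continuous_on \<Omega> g"
      using C by (simp_all add: f_def g_def numeral_2_eq_2)
    then have "isCont f x" "isCont g x"
      using assms by (simp_all add: continuous_on_eq_continuous_at)
    then obtain d1 d2 where d: "d1 > 0" "d2 > 0"
      "\<And>y. dist y x < d1 \<Longrightarrow> dist (f y) (f x) < ?e" "\<And>y. dist y x < d2 \<Longrightarrow> dist (g y) (g x) < ?e"
      using e unfolding continuous_at_eps_delta by metis
    obtain d3 where d3: "d3 > 0" "cball x d3 \<subseteq> \<Omega>"
      using assms(2,3) open_contains_cball by blast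
    \<comment> \<open>The intermediate points lie within \<open>2 * h\<close> of \<open>x\<close>,
      hence inside both continuity radii and inside \<Omega>.\<close>
    define h where "h = min d3 (min d1 d2) / 4"
    have h: "h > 0" "2 * h < d1" "2 * h < d2" "2 * h \<le> d3" using d d3 by (auto simp: h_def)
    then have sub: "cball x (2 * h) \<subseteq> \<Omega>" using d3 by auto
    obtain y where y: "dist x y \<le> 2 * h"
      "u (x + h *\<^sub>R axis i 1 + h *\<^sub>R axis j 1) - u (x + h *\<^sub>R axis i 1)
        - u (x + h *\<^sub>R axis j 1) + u x = h\<^sup>2 * f y"
      using mixed_difference_mean_value[OF C h(1) sub] unfolding f_def by metis
    obtain z where z: "dist x z \<le> 2 * h"
      "u (x + h *\<^sub>R axis j 1 + h *\<^sub>R axis i 1) - u (x + h *\<^sub>R axis j 1)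
        - u (x + h *\<^sub>R axis i 1) + u x = h\<^sup>2 * g z"
      using mixed_difference_mean_value[OF C h(1) sub] unfolding g_def by metis
    have swap: "x + h *\<^sub>R axis j 1 + h *\<^sub>R axis i 1 = x + h *\<^sub>R axis i 1 + h *\<^sub>R axis j 1"
      by (simp add: add_ac)
    have "h\<^sup>2 * f y = h\<^sup>2 * g z"
      using y(2) z(2) unfolding swap by linarith
    then have "f y = g z" using h(1) by simp
    moreover have "dist (f y) (f x) < ?e"
      by (rule d(3)) (use y h in \<open>simp add: dist_commute\<close>)
    moreover have "dist (g z) (g x) < ?e"
      by (rule d(4)) (use z h in \<open>simp add: dist_commute\<close>)
    ultimately show False
      using dist_triangle3[of "f x" "g x" "f y"] by simp
  qed
  then show ?thesis
    by (simp add: hessian_def transpose_def vec_eq_iff)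
qed

section \<open>Second-order conditions at a maximum of the doubled function\<close>

lemma second_derivative_nonpos_at_local_max:
  fixes h h' :: "real \<Rightarrow> real"
  assumes "0 < d" and h: "\<And>t. \<bar>t\<bar> < d \<Longrightarrow> (h has_real_derivative h' t) (at t)"
    and h': "(h' has_real_derivative c) (at 0)" and max: "\<And>t. \<bar>t\<bar> < d \<Longrightarrow> h t \<le> h 0"
  shows "c \<le> 0"
proof (rule ccontr)
  assume "\<not> c \<le> 0"
  then have "0 < c" by simp
  have "h' 0 = 0"
    using DERIV_local_max[OF h[of 0] \<open>0 < d\<close>] assms(1) max by simp
  with DERIV_pos_inc_right[OF h' \<open>0 < c\<close>] obtain d' where d': "d' > 0" "\<And>t. 0 < t \<Longrightarrow> t < d' \<Longrightarrow> 0 < h' t"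
    by auto
  define s where "s = min d d' / 2"
  have s: "0 < s" "s < d" "s < d'" using d' assms(1) by (auto simp: s_def)
  have "h 0 < h s"
  proof (rule DERIV_pos_imp_increasing_open[OF s(1)])
    show "\<exists>y. DERIV h t :> y \<and> y > 0" if "0 < t" "t < s" for t
      using h[of t] d'(2)[of t] that s by auto
    show "continuous_on {0..s} h"
      using s by (intro DERIV_atLeastAtMost_imp_continuous_on) (metis abs_of_nonneg h le_less_trans)
  qed
  with max[of s] s show False by auto
qed

text \<open>The pair moves along \<open>(x + t \<xi>, y + t \<eta>)\<close>. As
  \<open>\<xi> - \<eta>\<close> is parallel to \<open>x - y\<close>, the distance is the affine
  function \<open>s + t * \<alpha>\<close> near \<open>t = 0\<close>, so the norm itself adds no
  second derivative; the quadratic correction in the penalty alone yields the good term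
  \<open>L / (2 * \<delta>) * \<alpha>\<^sup>2\<close>.\<close>

lemma doubling_second_order:
  fixes u :: "real^'n::finite \<Rightarrow> real"
  assumes C: "C_on 2 \<Omega> u" and S: "open S" "S \<subseteq> \<Omega> \<times> \<Omega>" "(x, y) \<in> S" and "x \<noteq> y"
    and max: "\<And>a b. (a, b) \<in> S \<Longrightarrow>
      u a - u b - L * (norm (a - b) - (norm (a - b))\<^sup>2 / (4 * \<delta>)) - M * (norm (a - x0))\<^sup>2
      \<le> u x - u y - L * (norm (x - y) - (norm (x - y))\<^sup>2 / (4 * \<delta>)) - M * (norm (x - x0))\<^sup>2"
    and diff: "\<xi> - \<eta> = \<alpha> *\<^sub>R sgn (x - y)"
  shows "\<xi> \<bullet> (hessian u x *v \<xi>) - \<eta> \<bullet> (hessian u y *v \<eta>) + L / (2 * \<delta>) * \<alpha>\<^sup>2 \<le> 2 * M * (norm \<xi>)\<^sup>2"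
proof -
  define s c where "s = norm (x - y)" and "c = 1 / (4 * \<delta>)"
  have s: "s > 0" using \<open>x \<noteq> y\<close> by (simp add: s_def)
  have xy: "x - y = s *\<^sub>R sgn (x - y)" using s by (simp add: s_def sgn_div_norm)
  have "((\<lambda>t. (x + t *\<^sub>R \<xi>, y + t *\<^sub>R \<eta>)) \<longlongrightarrow> (x + 0 *\<^sub>R \<xi>, y + 0 *\<^sub>R \<eta>)) (at 0)"
    by (intro tendsto_intros)
  then have "\<forall>\<^sub>F t in at 0. (x + t *\<^sub>R \<xi>, y + t *\<^sub>R \<eta>) \<in> S"
    using S by (auto intro: topological_tendstoD)
  moreover have "((\<lambda>t. s + t * \<alpha>) \<longlongrightarrow> s + 0 * \<alpha>) (at 0)"
    by (intro tendsto_intros)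
  then have "\<forall>\<^sub>F t in at 0. s + t * \<alpha> > 0"
    using s by (auto intro: order_tendstoD)
  ultimately have "\<forall>\<^sub>F t in at 0. (x + t *\<^sub>R \<xi>, y + t *\<^sub>R \<eta>) \<in> S \<and> s + t * \<alpha> > 0"
    by (rule eventually_conj)
  then obtain d where d: "d > 0" and "\<And>t. t \<noteq> 0 \<Longrightarrow> dist t 0 < d \<Longrightarrow>
      (x + t *\<^sub>R \<xi>, y + t *\<^sub>R \<eta>) \<in> S \<and> s + t * \<alpha> > 0"
    unfolding eventually_at by blast
  then have near: "(x + t *\<^sub>R \<xi>, y + t *\<^sub>R \<eta>) \<in> S" "s + t * \<alpha> > 0" if "\<bar>t\<bar> < d" for t
    using that s S(3) by (cases "t = 0"; auto)+
  \<comment> \<open>The doubled function along the motion, with the norm replaced by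
    \<open>s + t * \<alpha>\<close> and the localising square expanded, so that it can be
    differentiated termwise. \<open>h_eq\<close> shows that it is the true function for small
    \<open>t\<close>.\<close>
  define h where "h t = u (x + t *\<^sub>R \<xi>) - u (y + t *\<^sub>R \<eta>)
    - L * ((s + t * \<alpha>) - c * (s + t * \<alpha>)\<^sup>2)
    - M * ((x - x0) \<bullet> (x - x0) + 2 * t * ((x - x0) \<bullet> \<xi>) + t\<^sup>2 * (\<xi> \<bullet> \<xi>))" for t
  define h' where "h' t = gradient u (x + t *\<^sub>R \<xi>) \<bullet> \<xi> - gradient u (y + t *\<^sub>R \<eta>) \<bullet> \<eta>
    - L * (\<alpha> - 2 * c * (s + t * \<alpha>) * \<alpha>) - M * (2 * ((x - x0) \<bullet> \<xi>) + 2 * t * (\<xi> \<bullet> \<xi>))" for t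
  have "h t = u (x + t *\<^sub>R \<xi>) - u (y + t *\<^sub>R \<eta>)
      - L * (norm (x + t *\<^sub>R \<xi> - (y + t *\<^sub>R \<eta>)) - (norm (x + t *\<^sub>R \<xi> - (y + t *\<^sub>R \<eta>)))\<^sup>2 / (4 * \<delta>))
      - M * (norm (x + t *\<^sub>R \<xi> - x0))\<^sup>2" if "\<bar>t\<bar> < d" for t
  proof -
    have "x + t *\<^sub>R \<xi> - (y + t *\<^sub>R \<eta>) = (x - y) + t *\<^sub>R (\<xi> - \<eta>)"
      by (simp add: algebra_simps)
    also have "\<dots> = (s + t * \<alpha>) *\<^sub>R sgn (x - y)"
      by (subst xy) (simp add: diff algebra_simps)
    finally have "norm (x + t *\<^sub>R \<xi> - (y + t *\<^sub>R \<eta>)) = s + t * \<alpha>"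
      using near(2)[OF that] \<open>x \<noteq> y\<close> by (simp add: norm_sgn)
    moreover have "(norm (x + t *\<^sub>R \<xi> - x0))\<^sup>2
        = (x - x0) \<bullet> (x - x0) + 2 * t * ((x - x0) \<bullet> \<xi>) + t\<^sup>2 * (\<xi> \<bullet> \<xi>)"
      unfolding power2_norm_eq_inner
      by (simp add: inner_add_left inner_add_right inner_diff_left inner_diff_right
          inner_commute power2_eq_square algebra_simps)
    ultimately show ?thesis by (simp add: h_def c_def)
  qed
  note h_eq = this
  have "\<xi> \<bullet> (hessian u x *v \<xi>) - \<eta> \<bullet> (hessian u y *v \<eta>)
      + L * (2 * c * \<alpha>\<^sup>2) - M * (2 * (\<xi> \<bullet> \<xi>)) \<le> 0"
  proof (rule second_derivative_nonpos_at_local_max[OF d])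
    fix t assume t: "\<bar>t\<bar> < d"
    have mem: "x + t *\<^sub>R \<xi> \<in> \<Omega>" "y + t *\<^sub>R \<eta> \<in> \<Omega>" using near(1)[OF t] S(2) by auto
    then have "u differentiable at (x + t *\<^sub>R \<xi>)" "u differentiable at (y + t *\<^sub>R \<eta>)"
      using C by (simp_all add: numeral_2_eq_2)
    then show "(h has_real_derivative h' t) (at t)"
      unfolding h_def h'_def
      by (auto intro!: derivative_eq_intros has_real_derivative_line)
    show "h t \<le> h 0"
      using max[OF near(1)[OF t]] d by (simp add: h_eq t)
  next
    have "x \<in> \<Omega>" "y \<in> \<Omega>" using S by auto
    then have "((\<lambda>t. gradient u (x + t *\<^sub>R \<xi>) \<bullet> \<xi>) has_real_derivative \<xi> \<bullet> (hessian u x *v \<xi>)) (at 0)"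
      "((\<lambda>t. gradient u (y + t *\<^sub>R \<eta>) \<bullet> \<eta>) has_real_derivative \<eta> \<bullet> (hessian u y *v \<eta>)) (at 0)"
      using has_real_derivative_gradient_line[OF C, of x 0 \<xi>]
        has_real_derivative_gradient_line[OF C, of y 0 \<eta>] by simp_all
    then show "(h' has_real_derivative \<xi> \<bullet> (hessian u x *v \<xi>) - \<eta> \<bullet> (hessian u y *v \<eta>)
      + L * (2 * c * \<alpha>\<^sup>2) - M * (2 * (\<xi> \<bullet> \<xi>))) (at 0)"
      unfolding h'_def
      by (auto intro!: derivative_eq_intros)
        (simp add: algebra_simps power2_eq_square)
  qed
  then show ?thesis
    by (simp add: power2_norm_eq_inner c_def)
qed

section \<open>Comparison of the Hessians at the two points\<close>

lemma bessel_inequality: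
  fixes v :: "'i \<Rightarrow> 'a::real_inner"
  assumes "finite I"
    and on: "\<And>i j. i \<in> I \<Longrightarrow> j \<in> I \<Longrightarrow> v i \<bullet> v j = (if i = j then 1 else 0)"
  shows "(\<Sum>i\<in>I. (v i \<bullet> z)\<^sup>2) \<le> (norm z)\<^sup>2"
proof -
  define w where "w = (\<Sum>i\<in>I. (v i \<bullet> z) *\<^sub>R v i)"
  have vw: "v i \<bullet> w = v i \<bullet> z" if "i \<in> I" for i
    using assms(1) that by (simp add: w_def inner_sum_right on if_distrib cong: if_cong)
  have "w \<bullet> z = (\<Sum>i\<in>I. (v i \<bullet> z)\<^sup>2)"
    by (simp add: w_def inner_sum_left power2_eq_square)
  moreover have "w \<bullet> w = (\<Sum>i\<in>I. (v i \<bullet> z)\<^sup>2)"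
    by (subst (1) w_def) (simp add: inner_sum_left power2_eq_square vw)
  moreover have "0 \<le> (z - w) \<bullet> (z - w)" by simp
  ultimately show ?thesis
    by (simp add: power2_norm_eq_inner inner_diff_left inner_diff_right inner_commute)
qed

text \<open>Applied with \<open>X\<close>, \<open>Y\<close> the Hessians at the two points and
  \<open>l = L / (2 * \<delta>)\<close>. If \<open>l\<close> were large, \<open>X\<close> would be
  very negative along \<open>e\<close>, so nonnegativity of its \<open>p\<close>-traces would
  require a large trace \<open>T\<close> on the projected frame, whereas the coupling with
  \<open>Y\<close> bounds \<open>T\<close>.\<close>

lemma coupled_hessians_bound:
  fixes X Y :: "real^'n^'n::finite" and v :: "'i \<Rightarrow> real^'n"
  assumes sym: "transpose X = X" and p: "1 < p" "p \<le> CARD('n)"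
    and nonneg: "\<And>I. I \<subseteq> {..<CARD('n)} \<Longrightarrow> card I = p \<Longrightarrow> (\<Sum>i\<in>I. eigenvalues X ! i) \<ge> 0"
    and e: "norm e = 1" and I: "finite I" "card I = p"
    and on: "\<And>i j. i \<in> I \<Longrightarrow> j \<in> I \<Longrightarrow> v i \<bullet> v j = (if i = j then 1 else 0)"
    and tr: "(\<Sum>i\<in>I. v i \<bullet> (Y *v v i)) \<le> \<kappa>"
    and coupled: "\<And>\<xi> \<eta> \<alpha>. \<xi> - \<eta> = \<alpha> *\<^sub>R e \<Longrightarrow>
      \<xi> \<bullet> (X *v \<xi>) - \<eta> \<bullet> (Y *v \<eta>) + l * \<alpha>\<^sup>2 \<le> 2 * M * (norm \<xi>)\<^sup>2"
    and pos: "0 \<le> \<kappa>" "0 \<le> M"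
  shows "l \<le> \<kappa> + 2 * M * (p + 1)"
proof (rule ccontr)
  assume "\<not> ?thesis"
  then have l: "\<kappa> + 2 * M * p < l - 2 * M" by (simp add: algebra_simps)
  have Mp: "0 \<le> \<kappa> + 2 * M * p" using pos by simp
  have ee: "e \<bullet> e = 1" using e by (simp add: norm_eq_1)
  define P where "P z = z - (e \<bullet> z) *\<^sub>R e" for z
  define c where "c = (\<Sum>i\<in>I. (e \<bullet> v i)\<^sup>2)"
  define a where "a = e \<bullet> (X *v e)"
  define T where "T = (\<Sum>i\<in>I. P (v i) \<bullet> (X *v P (v i)))"
  have c: "0 \<le> c" "c \<le> 1"
    using bessel_inequality[OF I(1) on, of e] e by (auto simp: c_def sum_nonneg inner_commute)
  have a: "a \<le> 2 * M - l"
    using coupled[of e 0 1] e by (simp add: a_def)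
  \<comment> \<open>Average of the coupled inequality for \<open>\<eta> = v i\<close> over
    \<open>\<xi> = v i\<close> and \<open>\<xi>\<close> its reflection in the hyperplane orthogonal
    to \<open>e\<close>. Averaging cancels the mixed terms between \<open>e\<close> and
    \<open>P (v i)\<close>; the reflection has \<open>\<alpha> = - 2 * s\<close>, which produces the
    extra \<open>2 * l * (e \<bullet> v i)\<^sup>2\<close>.\<close>
  have reflect: "(e \<bullet> v i)\<^sup>2 * a + P (v i) \<bullet> (X *v P (v i)) + 2 * l * (e \<bullet> v i)\<^sup>2
      \<le> v i \<bullet> (Y *v v i) + 2 * M" if "i \<in> I" for i
  proof -
    define s where "s = e \<bullet> v i"
    define z where "z = P (v i)"
    have v: "v i = z + s *\<^sub>R e" by (simp add: z_def P_def s_def)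
    have "v i \<bullet> v i = 1" using on[OF that that] by simp
    moreover have ez: "e \<bullet> z = 0" by (simp add: z_def P_def inner_diff_right ee)
    ultimately have nrm: "(norm (z + s *\<^sub>R e))\<^sup>2 = 1" "(norm (z - s *\<^sub>R e))\<^sup>2 = 1"
      unfolding power2_norm_eq_inner v
      by (auto simp: inner_add_left inner_add_right inner_diff_left inner_diff_right inner_commute)
    have "(z + s *\<^sub>R e) \<bullet> (X *v (z + s *\<^sub>R e)) - v i \<bullet> (Y *v v i) \<le> 2 * M"
      using coupled[of "v i" "v i" 0] nrm v by simp
    moreover have "(z - s *\<^sub>R e) \<bullet> (X *v (z - s *\<^sub>R e)) - v i \<bullet> (Y *v v i) + l * (- 2 * s)\<^sup>2 \<le> 2 * M"
      using coupled[of "z - s *\<^sub>R e" "v i" "- 2 * s"] nrm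
      by (simp add: v algebra_simps flip: scaleR_add_left)
    moreover have "(z + s *\<^sub>R e) \<bullet> (X *v (z + s *\<^sub>R e)) + (z - s *\<^sub>R e) \<bullet> (X *v (z - s *\<^sub>R e))
        = 2 * (s\<^sup>2 * a + z \<bullet> (X *v z))"
      by (simp add: a_def matrix_vector_right_distrib matrix_vector_mult_diff_distrib
          matrix_vector_mult_scaleR inner_add_left inner_add_right
          inner_diff_left inner_diff_right power2_eq_square algebra_simps)
    ultimately show ?thesis
      by (simp add: s_def[symmetric] z_def[symmetric] algebra_simps)
  qed
  have sum: "c * a + T + 2 * l * c \<le> \<kappa> + 2 * M * p"
    using sum_mono[OF reflect, of I "\<lambda>i. i"] tr I
    by (simp add: sum.distrib c_def T_def sum_distrib_right sum_distrib_left algebra_simps)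
  \<comment> \<open>\<open>\<theta>\<close> is chosen so that \<open>e e\<^sup>T + \<theta> \<Sum>\<^sub>i (P v\<^sub>i) (P v\<^sub>i)\<^sup>T\<close> has trace \<open>p\<close>.\<close>
  define \<theta> where "\<theta> = (real p - 1) / (real p - c)"
  have \<theta>: "0 \<le> \<theta>" "\<theta> \<le> 1" "\<theta> * (real p - c) = real p - 1"
    using p c by (auto simp: \<theta>_def field_simps)
  \<comment> \<open>The index \<open>None\<close> carries \<open>e\<close> and \<open>Some i\<close>
    the rescaled projection of \<open>v i\<close>, so that the whole family is one test family for
    \<open>sum_quadratic_form_nonneg\<close>.\<close>
  define y where "y = case_option e (\<lambda>i. sqrt \<theta> *\<^sub>R P (v i))"
  have sum_y: "(\<Sum>j\<in>insert None (Some ` I). f j) = f None + (\<Sum>i\<in>I. f (Some i))"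
    for f :: "'i option \<Rightarrow> real"
    using I by (subst sum.insert) (auto simp: sum.reindex)
  have "0 \<le> (\<Sum>j\<in>insert None (Some ` I). y j \<bullet> (X *v y j))"
  proof (rule sum_quadratic_form_nonneg[OF sym _ p(2) nonneg])
    show "0 < p" using p by simp
    show "(\<Sum>j\<in>insert None (Some ` I). (norm (y j))\<^sup>2) = real p"
    proof -
      have "(norm (P z))\<^sup>2 = z \<bullet> z - (e \<bullet> z)\<^sup>2" for z
        unfolding power2_norm_eq_inner P_def
        by (simp add: inner_diff_left inner_diff_right ee inner_commute power2_eq_square)
      then have "(\<Sum>i\<in>I. (norm (P (v i)))\<^sup>2) = real p - c"
        using on I by (simp add: c_def sum_subtractf)
      then show ?thesis
        using \<theta> e by (simp add: sum_y y_def power_mult_distrib flip: sum_distrib_left)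
    qed
    show "(\<Sum>j\<in>insert None (Some ` I). (y j \<bullet> z)\<^sup>2) \<le> (norm z)\<^sup>2" for z
    proof -
      \<comment> \<open>\<open>P\<close> is the self-adjoint projection along \<open>e\<close>.
        Bessel for \<open>v\<close> at \<open>P z\<close>, together with
        \<open>\<theta> \<le> 1\<close> and Pythagoras, leaves room for exactly the contribution of
        \<open>e\<close>.\<close>
      have "P w \<bullet> z = w \<bullet> P z" for w
        by (simp add: P_def inner_diff_left inner_diff_right inner_commute)
      then have "(\<Sum>i\<in>I. (P (v i) \<bullet> z)\<^sup>2) \<le> (norm (P z))\<^sup>2"
        using bessel_inequality[OF I(1) on, of "P z"] by simp
      moreover have "(norm (P z))\<^sup>2 = (norm z)\<^sup>2 - (e \<bullet> z)\<^sup>2"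
        unfolding power2_norm_eq_inner P_def
        by (simp add: inner_diff_left inner_diff_right ee inner_commute power2_eq_square)
      moreover have "\<theta> * (\<Sum>i\<in>I. (P (v i) \<bullet> z)\<^sup>2) \<le> 1 * (\<Sum>i\<in>I. (P (v i) \<bullet> z)\<^sup>2)"
        using \<theta> by (intro mult_right_mono sum_nonneg) auto
      ultimately show ?thesis
        using \<theta> by (simp add: sum_y y_def power_mult_distrib flip: sum_distrib_left)
    qed
  qed
  then have "0 \<le> a + \<theta> * T"
    using \<theta> by (simp add: sum_y y_def a_def T_def matrix_vector_mult_scaleR sum_distrib_left
        flip: mult.assoc)
  then have aT: "- a \<le> \<theta> * T" by simp
  have "0 \<le> l" using l Mp pos by linarith
  have "0 < - a" using a l Mp by linarith
  then have "0 < \<theta> * T" using aT by linarith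
  then have "0 \<le> T" using \<theta>(1) by (simp add: zero_less_mult_iff)
  then have "\<theta> * T \<le> T" using \<theta> mult_right_mono[of \<theta> 1 T] by simp
  \<comment> \<open>Here \<open>T \<ge> - a\<close>. The two estimates that follow split
    \<open>l - 2 * M\<close> with weights \<open>1 - c\<close> and \<open>c\<close>: the first share
    is covered by \<open>- a\<close>, the second by the reflection term \<open>2 * l * c\<close>.
    Thus no lower bound on \<open>c\<close> enters.\<close>
  then have "(1 - c) * (- a) \<le> c * a + T" using aT by (simp add: algebra_simps)
  moreover have "(1 - c) * (l - 2 * M) \<le> (1 - c) * (- a)"
    using a c by (intro mult_left_mono) auto
  moreover have "c * (l - 2 * M) \<le> c * (2 * l)"
    using c pos \<open>0 \<le> l\<close> by (intro mult_left_mono) auto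
  ultimately have "l - 2 * M \<le> c * a + T + 2 * l * c"
    by (simp add: algebra_simps)
  with sum l show False by linarith
qed

section \<open>The interior gradient estimate\<close>

lemma exists_small_eigenvalue_sum:
  fixes u :: "real^'n::finite \<Rightarrow> real"
  assumes "M_op p u x \<le> K" "0 \<le> K" "p \<le> CARD('n)"
  obtains I where "I \<subseteq> {..<CARD('n)}" "card I = p" "(\<Sum>i\<in>I. eigenvalues (hessian u x) ! i) \<le> K + 1"
proof (rule ccontr)
  note small = that
  let ?J = "{I. I \<subseteq> {..<CARD('n)} \<and> card I = p}"
  let ?s = "\<lambda>I. \<Sum>i\<in>I. eigenvalues (hessian u x) ! i"
  assume no: "\<not> thesis"
  have big: "K + 1 \<le> ?s I" if "I \<in> ?J" for I
    using no \<open>I \<in> ?J\<close> small[of I] by (cases "?s I \<le> K + 1") auto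
  have fin: "finite ?J" by (rule finite_subset[of _ "Pow {..<CARD('n)}"]) auto
  have J: "{..<p} \<in> ?J" using assms(3) by auto
  \<comment> \<open>One factor is at least \<open>K + 1\<close>, and the remaining ones are at least
    1 because \<open>K\<close> is nonnegative, so the product exceeds \<open>K\<close> whatever the
    number of factors.\<close>
  have "K + 1 \<le> ?s {..<p} * 1" using big[OF J] by simp
  also have "\<dots> \<le> ?s {..<p} * (\<Prod>I\<in>?J - {{..<p}}. ?s I)"
  proof (intro mult_left_mono prod_ge_1)
    show "1 \<le> ?s I" if "I \<in> ?J - {{..<p}}" for I
      using big[of I] that assms(2) by auto
    show "0 \<le> ?s {..<p}" using big[OF J] assms(2) by linarith
  qed
  also have "\<dots> = M_op p u x"
    unfolding M_op_def by (rule prod.remove[OF fin J, symmetric])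
  finally show False using assms(1) by simp
qed

text \<open>A one-sided bound suffices: in the direction opposite to the gradient, \<open>u\<close>
  decreases at rate \<open>norm (gradient u x)\<close>.\<close>

lemma gradient_norm_le:
  fixes u :: "real^'n::finite \<Rightarrow> real"
  assumes "u differentiable at x" "0 < d" "0 \<le> L" "\<And>y. dist x y < d \<Longrightarrow> u x - u y \<le> L * dist x y"
  shows "norm (gradient u x) \<le> L"
proof (rule ccontr)
  assume contra: "\<not> ?thesis"
  define g where "g = gradient u x"
  define w where "w = - sgn g"
  define k where "k t = u x - u (x + t *\<^sub>R w) - L * t" for t
  have "(k has_real_derivative 0 - gradient u (x + 0 *\<^sub>R w) \<bullet> w - L * 1) (at 0)"
    unfolding k_def using assms(1)
    by (intro DERIV_diff DERIV_cmult DERIV_const DERIV_ident has_real_derivative_line) simp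
  moreover have "g \<bullet> w = - norm g"
    by (simp add: w_def sgn_div_norm dot_square_norm power2_eq_square field_simps)
  ultimately have "(k has_real_derivative norm g - L) (at 0)"
    by (simp add: g_def)
  from DERIV_pos_inc_right[OF this] contra obtain d' where
    d': "0 < d'" "\<And>t. 0 < t \<Longrightarrow> t < d' \<Longrightarrow> k 0 < k t"
    by (auto simp: g_def)
  define t where "t = min d d' / 2"
  have t: "0 < t" "t < d" "t < d'" using assms(2) d' by (auto simp: t_def)
  have k: "0 < k t" using d'(2)[of t] t by (simp add: k_def)
  show False
  \<comment> \<open>\<open>w\<close> is a unit vector only for nonzero \<open>g\<close>, since
    \<open>sgn 0 = 0\<close>.\<close>
  proof (cases "g = 0")
    case True
    then show False using contra \<open>0 \<le> L\<close> by (simp add: g_def)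
  next
    case False
    then have "dist x (x + t *\<^sub>R w) = t"
      using t by (simp add: dist_norm w_def norm_sgn)
    then show False using assms(4)[of "x + t *\<^sub>R w"] t k by (simp add: k_def)
  qed
qed

lemma interior_gradient_bound:
  fixes u :: "real^'n::finite \<Rightarrow> real"
  assumes p: "1 < p" "p < CARD('n)" and "0 < r" and psh: "p_plurisubharmonic p (ball x0 r) u"
    and bound: "\<And>x. x \<in> ball x0 r \<Longrightarrow> \<bar>u x\<bar> \<le> m"
    and rhs: "\<And>x. x \<in> ball x0 r \<Longrightarrow> M_op p u x \<le> K" and "0 \<le> K"
  shows "norm (gradient u x0) \<le> 16 * m / r + r / 2 * (K + 2 + 16 * m / r\<^sup>2 * (p + 1))"
proof -
  \<comment> \<open>\<open>\<delta> = r / 4\<close> keeps \<open>y\<close> within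
    \<open>3 * r / 4\<close> of \<open>x0\<close> when \<open>x\<close> is within
    \<open>r / 2\<close>. \<open>M\<close> satisfies \<open>M * (r / 2)\<^sup>2 = 2 * m\<close>,
    which excludes a positive maximum with \<open>x\<close> on that sphere. The first term of
    \<open>L\<close> excludes \<open>dist x y = \<delta>\<close>, and the second makes
    \<open>L / (2 * \<delta>)\<close> exceed the bound of \<open>coupled_hessians_bound\<close> with
    \<open>\<kappa> = K + 1\<close>.\<close>
  define \<delta> M where "\<delta> = r / 4" and "M = 8 * m / r\<^sup>2"
  define L where "L = 4 * m / \<delta> + 2 * \<delta> * (K + 2 + 2 * M * (p + 1))"
  have C: "C_on 2 (ball x0 r) u" using psh by (simp add: p_plurisubharmonic_def)
  have m: "0 \<le> m" using bound[of x0] \<open>0 < r\<close> by (simp add: order_trans[OF abs_ge_zero])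
  have \<delta>: "0 < \<delta>" and M: "0 \<le> M" using \<open>0 < r\<close> m by (simp_all add: \<delta>_def M_def)
  have L: "0 \<le> L" "4 * m \<le> L * \<delta>"
    using \<delta> m M \<open>0 \<le> K\<close> by (auto simp: L_def field_simps)
  define \<Psi> where "\<Psi> a b = u a - u b - L * (norm (a - b) - (norm (a - b))\<^sup>2 / (4 * \<delta>))
    - M * (norm (a - x0))\<^sup>2" for a b
  define D where "D = (cball x0 (r / 2) \<times> cball x0 (3 * r / 4)) \<inter> {z. dist (fst z) (snd z) \<le> \<delta>}"
  have D: "a \<in> ball x0 r" "b \<in> ball x0 r" "dist a b \<le> \<delta>" "dist x0 a \<le> r / 2" if "(a, b) \<in> D" for a b
    using that \<open>0 < r\<close> by (auto simp: D_def)
  have memD: "(a, b) \<in> D" if "dist x0 a \<le> r / 2" "dist a b \<le> \<delta>" for a b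
    using that dist_triangle[of x0 b a] by (simp add: D_def \<delta>_def)
  have "\<Psi> a b \<le> 0" if ab: "(a, b) \<in> D" for a b
  proof (rule ccontr)
    assume "\<not> ?thesis"
    have "compact D"
      unfolding D_def
      by (intro compact_Int_closed compact_Times compact_cball closed_Collect_le continuous_intros)
    moreover have "continuous_on D (\<lambda>z. \<Psi> (fst z) (snd z))"
    proof -
      have "continuous_on (ball x0 r) u"
        using C by (auto intro!: continuous_at_imp_continuous_on differentiable_imp_continuous_within
            simp: numeral_2_eq_2)
      then have "continuous_on D (\<lambda>z. u (fst z))" "continuous_on D (\<lambda>z. u (snd z))"
        using D by (auto elim!: continuous_on_compose2 intro!: continuous_intros)
      then show ?thesis
        unfolding \<Psi>_def using \<delta> by (intro continuous_intros) auto
    qed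
    ultimately obtain x y where xy: "(x, y) \<in> D" and max: "\<And>a b. (a, b) \<in> D \<Longrightarrow> \<Psi> a b \<le> \<Psi> x y"
      using continuous_attains_sup[of D "\<lambda>z. \<Psi> (fst z) (snd z)"] ab by force
    have pos: "0 < \<Psi> x y" using max[OF ab] \<open>\<not> _\<close> by simp
    have le: "\<Psi> x y \<le> 2 * m - L * (norm (x - y) - (norm (x - y))\<^sup>2 / (4 * \<delta>)) - M * (norm (x - x0))\<^sup>2"
      using bound[OF D(1)[OF xy]] bound[OF D(2)[OF xy]] by (simp add: \<Psi>_def)
    \<comment> \<open>On \<open>D\<close> the distance is at most \<delta>, so the concave
      correction costs at most a quarter of the linear term.\<close>
    have phi: "norm (x - y) / 2 \<le> norm (x - y) - (norm (x - y))\<^sup>2 / (4 * \<delta>)"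
    proof -
      have "(norm (x - y))\<^sup>2 \<le> \<delta> * norm (x - y)"
        using D(3)[OF xy] by (simp add: power2_eq_square dist_norm mult_right_mono)
      then have "(norm (x - y))\<^sup>2 / (4 * \<delta>) \<le> norm (x - y) / 4"
        using \<delta> by (simp add: field_simps)
      then show ?thesis using norm_ge_zero[of "x - y"] by linarith
    qed
    then have Lphi: "L * (norm (x - y) / 2) \<le> L * (norm (x - y) - (norm (x - y))\<^sup>2 / (4 * \<delta>))"
      using L by (intro mult_left_mono)
    \<comment> \<open>On the diagonal \<open>\<Psi>\<close> is nonpositive; away from it the norm is
      smooth.\<close>
    have "x \<noteq> y" using pos mult_nonneg_nonneg[OF M, of "(norm (x - x0))\<^sup>2"] by (auto simp: \<Psi>_def)
    have "dist x y \<noteq> \<delta>"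
    proof
      assume "dist x y = \<delta>"
      then have "2 * m \<le> L * (norm (x - y) / 2)" using L by (simp add: dist_norm)
      moreover have "0 \<le> M * (norm (x - x0))\<^sup>2" using M by simp
      ultimately show False using Lphi le pos by linarith
    qed
    moreover have "dist x0 x \<noteq> r / 2"
    proof
      assume "dist x0 x = r / 2"
      then have nrm: "norm (x - x0) = r / 2" by (simp add: dist_norm norm_minus_commute)
      have "M * (norm (x - x0))\<^sup>2 = 2 * m"
        unfolding M_def nrm using \<open>0 < r\<close> by (simp add: power_divide)
      moreover have "0 \<le> L * (norm (x - y) / 2)" using L by simp
      ultimately show False using Lphi le pos by linarith
    qed
    ultimately have strict: "dist x y < \<delta>" "dist x0 x < r / 2" using D(3,4)[OF xy] by auto
    \<comment> \<open>Strict inequalities turn \<open>D\<close> into an open set that still contains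
      the maximum point, as needed for the second-order conditions.\<close>
    define S where "S = {z. dist x0 (fst z) < r / 2 \<and> dist (fst z) (snd z) < \<delta>}"
    have SD: "z \<in> D" if "z \<in> S" for z
      using that memD[of "fst z" "snd z"] by (simp add: S_def)
    have "open S"
      unfolding S_def by (intro open_Collect_conj open_Collect_less continuous_intros)
    moreover have "S \<subseteq> ball x0 r \<times> ball x0 r"
      using D(1,2)[OF SD] by force
    moreover have "(x, y) \<in> S" using strict by (simp add: S_def)
    ultimately have coupled: "\<xi> \<bullet> (hessian u x *v \<xi>) - \<eta> \<bullet> (hessian u y *v \<eta>) + L / (2 * \<delta>) * \<alpha>\<^sup>2
        \<le> 2 * M * (norm \<xi>)\<^sup>2" if "\<xi> - \<eta> = \<alpha> *\<^sub>R sgn (x - y)" for \<xi> \<eta> \<alpha>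
      using max[OF SD] that unfolding \<Psi>_def by (rule doubling_second_order[OF C _ _ _ \<open>x \<noteq> y\<close>])
    have sym: "transpose (hessian u z) = hessian u z" if "z \<in> ball x0 r" for z
      using hessian_symmetric[OF C _ that] by simp
    obtain q where on: "\<And>i j. i < CARD('n) \<Longrightarrow> j < CARD('n) \<Longrightarrow> q i \<bullet> q j = (if i = j then 1 else 0)"
      and eig: "\<And>i. i < CARD('n) \<Longrightarrow> hessian u y *v q i = (eigenvalues (hessian u y) ! i) *\<^sub>R q i"
      by (rule eigenvalues_eigenbasis[OF sym[OF D(2)[OF xy]]]) (rule that)
    obtain I where I: "I \<subseteq> {..<CARD('n)}" "card I = p"
      "(\<Sum>i\<in>I. eigenvalues (hessian u y) ! i) \<le> K + 1"
      using exists_small_eigenvalue_sum[OF rhs[OF D(2)[OF xy]] \<open>0 \<le> K\<close>, of thesis] p by auto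
    have "(\<Sum>i\<in>I. q i \<bullet> (hessian u y *v q i)) = (\<Sum>i\<in>I. eigenvalues (hessian u y) ! i)"
      using I(1) by (intro sum.cong refl) (auto simp: eig on subset_iff)
    then have tr: "(\<Sum>i\<in>I. q i \<bullet> (hessian u y *v q i)) \<le> K + 1" using I(3) by simp
    have "L / (2 * \<delta>) \<le> K + 1 + 2 * M * (p + 1)"
    proof (rule coupled_hessians_bound[OF sym[OF D(1)[OF xy]] p(1) _ _ _ _ I(2) _ tr coupled])
      show "finite I" using I(1) finite_subset by blast
      show "0 \<le> (\<Sum>i\<in>J. eigenvalues (hessian u x) ! i)" if "J \<subseteq> {..<CARD('n)}" "card J = p" for J
        using psh D(1)[OF xy] that by (simp add: p_plurisubharmonic_def)
    qed (use p I(1) \<open>x \<noteq> y\<close> M \<open>0 \<le> K\<close> in \<open>auto simp: norm_sgn subset_iff on\<close>)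
    moreover have "L / (2 * \<delta>) = 2 * m / \<delta>\<^sup>2 + (K + 2 + 2 * M * (p + 1))"
      using \<delta> by (simp add: L_def field_simps power2_eq_square)
    moreover have "0 \<le> 2 * m / \<delta>\<^sup>2" using m by simp
    ultimately show False by linarith
  qed
  note nonpos = this
  have "norm (gradient u x0) \<le> L"
  proof (rule gradient_norm_le[OF _ \<delta> L(1)])
    show "u differentiable at x0" using C \<open>0 < r\<close> by (simp add: numeral_2_eq_2)
    \<comment> \<open>With first argument \<open>x0\<close> the localising term vanishes, and
      dropping the concave correction leaves a linear bound.\<close>
    show "u x0 - u y \<le> L * dist x0 y" if "dist x0 y < \<delta>" for y
    proof -
      have "\<Psi> x0 y \<le> 0" using that \<open>0 < r\<close> by (intro nonpos memD) auto
      moreover have "L * (norm (x0 - y) - (norm (x0 - y))\<^sup>2 / (4 * \<delta>)) \<le> L * norm (x0 - y)"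
        using L \<delta> by (intro mult_left_mono) auto
      ultimately show ?thesis by (simp add: \<Psi>_def dist_norm)
    qed
  qed
  also have "L = 16 * m / r + r / 2 * (K + 2 + 16 * m / r\<^sup>2 * (p + 1))"
    by (simp add: L_def \<delta>_def M_def)
  finally show ?thesis .
qed

theorem theorem0p3:
  fixes p :: nat
  assumes "1 < p" and "p < CARD('n::finite)"
  shows "\<exists>C :: real \<Rightarrow> real \<Rightarrow> real \<Rightarrow> real.
    \<forall>(x0 :: real^'n) r u f K.
      0 < r \<longrightarrow>
      C_on 3 (ball x0 r) u \<longrightarrow>
      C1_on_closure (ball x0 r) u \<longrightarrow>
      p_plurisubharmonic p (ball x0 r) u \<longrightarrow>
      (\<forall>x\<in>ball x0 r. \<forall>z. 0 \<le> f x z) \<longrightarrow>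
      lipschitz_fun (ball x0 r) f \<longrightarrow>
      lipschitz_bound (ball x0 r) f K \<longrightarrow>
      (\<forall>x\<in>ball x0 r. M_op p u x = f x (u x)) \<longrightarrow>
      norm (gradient u x0) \<le> C r (SUP x\<in>ball x0 r. \<bar>u x\<bar>) K"
proof (intro exI[of _ "\<lambda>r m K. 16 * m / r + r / 2 * (K + 2 + 16 * m / r\<^sup>2 * (p + 1))"] allI impI)
  fix x0 :: "real^'n" and r K :: real and u f
  assume r: "0 < r" and cl: "C1_on_closure (ball x0 r) u" and psh: "p_plurisubharmonic p (ball x0 r) u"
    and f0: "\<forall>x\<in>ball x0 r. \<forall>z. 0 \<le> f x z" and K: "lipschitz_bound (ball x0 r) f K"
    and eq: "\<forall>x\<in>ball x0 r. M_op p u x = f x (u x)"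
  have fK: "\<bar>f x z\<bar> \<le> K" if "x \<in> ball x0 r" for x z
    using K that by (simp add: lipschitz_bound_def)
  \<comment> \<open>Continuity up to the boundary makes the set of values bounded, so that the
    supremum really is an upper bound for \<open>\<bar>u x\<bar>\<close>.\<close>
  have "continuous_on (cball x0 r) u"
    using cl r by (simp add: C1_on_closure_def)
  then have "compact ((\<lambda>x. \<bar>u x\<bar>) ` cball x0 r)"
    by (intro compact_continuous_image continuous_intros compact_cball)
  then have "bdd_above ((\<lambda>x. \<bar>u x\<bar>) ` ball x0 r)"
    by (meson ball_subset_cball bdd_above_mono bounded_imp_bdd_above compact_imp_bounded image_mono)
  then have "\<bar>u x\<bar> \<le> (SUP x\<in>ball x0 r. \<bar>u x\<bar>)" if "x \<in> ball x0 r" for x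
    using that by (intro cSUP_upper)
  moreover have "M_op p u x \<le> K" if "x \<in> ball x0 r" for x
    using fK[OF that, of "u x"] eq that by auto
  moreover have "0 \<le> K" using fK[of x0] r by (meson abs_ge_zero centre_in_ball order_trans)
  ultimately show "norm (gradient u x0) \<le> 16 * (SUP x\<in>ball x0 r. \<bar>u x\<bar>) / r
      + r / 2 * (K + 2 + 16 * (SUP x\<in>ball x0 r. \<bar>u x\<bar>) / r\<^sup>2 * (p + 1))"
    by (rule interior_gradient_bound[OF assms r psh])
qed

end
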